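(* (Catalan's identity.) For every integer $n \ge 1$ and every integer $r \ge 0$, \[ (Q^P_n)^2 - Q^P_{n+r}\,Q^P_{n-r} = (-1)^{n-r}\,P_r^2\; 2\,(1 + i + 6\varepsilon + 6\,i\varepsilon). \]
   Context: Dual-complex numbers are expressions $x_1 + i\,x_2 + \varepsilon\,y_1 + i\varepsilon\,y_2$ with real coefficients, forming a commutative associative real algebra with basis $\{1,i,\varepsilon,i\varepsilon\}$, where $i^2=-1$, $\varepsilon\ne 0$, $\varepsilon^2=0$, $i\varepsilon=\varepsilon i$, $(i\varepsilon)^2=0$. Pell numbers: $P_0=0$, $P_1=1$, $P_n=2P_{n-1}+P_{n-2}$, extended to negative indices by the same recurrence, i.e. $P_{-k}=(-1)^{k+1}P_k$. The dual-complex Pell quaternion is $Q^P_k = P_k + i\,P_{k+1} + \varepsilon\,P_{k+2} + i\varepsilon\,P_{k+3}$ for every integer $k$, with products taken in the dual-complex algebra. *)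

theory Defs
  imports Complex_Main
begin

text \<open>\<open>DC x1 x2 y1 y2\<close> stands for \<open>x1 + i x2 + \<epsilon> y1 + i\<epsilon> y2\<close>.\<close>

datatype dual_complex = DC (dc_1: real) (dc_2: real) (dc_3: real) (dc_4: real)

instantiation dual_complex :: "{comm_ring_1, real_algebra_1}"
begin

definition zero_dual_complex :: dual_complex
  where "0 = DC 0 0 0 0"

definition one_dual_complex :: dual_complex
  where "1 = DC 1 0 0 0"

definition plus_dual_complex :: "dual_complex \<Rightarrow> dual_complex \<Rightarrow> dual_complex"
  where "x + y = DC (dc_1 x + dc_1 y) (dc_2 x + dc_2 y) (dc_3 x + dc_3 y) (dc_4 x + dc_4 y)"

definition uminus_dual_complex :: "dual_complex \<Rightarrow> dual_complex"
  where "- x = DC (- dc_1 x) (- dc_2 x) (- dc_3 x) (- dc_4 x)"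

definition minus_dual_complex :: "dual_complex \<Rightarrow> dual_complex \<Rightarrow> dual_complex"
  where "x - y = DC (dc_1 x - dc_1 y) (dc_2 x - dc_2 y) (dc_3 x - dc_3 y) (dc_4 x - dc_4 y)"

definition scaleR_dual_complex :: "real \<Rightarrow> dual_complex \<Rightarrow> dual_complex"
  where "scaleR c x = DC (c * dc_1 x) (c * dc_2 x) (c * dc_3 x) (c * dc_4 x)"

text \<open>The bilinear extension of \<open>i\<^sup>2 = -1\<close>, \<open>\<epsilon>\<^sup>2 = 0\<close>, \<open>i\<epsilon> = \<epsilon>i\<close>, \<open>(i\<epsilon>)\<^sup>2 = 0\<close>.\<close>

definition times_dual_complex :: "dual_complex \<Rightarrow> dual_complex \<Rightarrow> dual_complex"
  where "x * y =
    DC (dc_1 x * dc_1 y - dc_2 x * dc_2 y)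
       (dc_1 x * dc_2 y + dc_2 x * dc_1 y)
       (dc_1 x * dc_3 y + dc_3 x * dc_1 y - dc_2 x * dc_4 y - dc_4 x * dc_2 y)
       (dc_1 x * dc_4 y + dc_4 x * dc_1 y + dc_2 x * dc_3 y + dc_3 x * dc_2 y)"

instance
  by standard
    (simp_all add: zero_dual_complex_def one_dual_complex_def plus_dual_complex_def
      uminus_dual_complex_def minus_dual_complex_def scaleR_dual_complex_def
      times_dual_complex_def dual_complex.expand algebra_simps)

end

definition dc_i :: dual_complex
  where "dc_i = DC 0 1 0 0"

definition dc_eps :: dual_complex
  where "dc_eps = DC 0 0 1 0"

lemma dc_unit_rules:
  "dc_i\<^sup>2 = -1" "dc_eps \<noteq> 0" "dc_eps\<^sup>2 = 0" "dc_i * dc_eps = dc_eps * dc_i" "(dc_i * dc_eps)\<^sup>2 = 0"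
  by (simp_all add: dc_i_def dc_eps_def power2_eq_square zero_dual_complex_def
      one_dual_complex_def uminus_dual_complex_def times_dual_complex_def)

lemma DC_expansion:
  "DC x1 x2 y1 y2 =
    x1 *\<^sub>R 1 + x2 *\<^sub>R dc_i + y1 *\<^sub>R dc_eps + y2 *\<^sub>R (dc_i * dc_eps)"
  by (simp add: dc_i_def dc_eps_def one_dual_complex_def plus_dual_complex_def
      scaleR_dual_complex_def times_dual_complex_def)

fun pell_nat :: "nat \<Rightarrow> int"
  where
    "pell_nat 0 = 0"
  | "pell_nat (Suc 0) = 1"
  | "pell_nat (Suc (Suc n)) = 2 * pell_nat (Suc n) + pell_nat n"

definition pell :: "int \<Rightarrow> int"
  where "pell k =
    (if 0 \<le> k then pell_nat (nat k) else (-1) ^ (nat (- k) + 1) * pell_nat (nat (- k)))"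

lemma pell_0: "pell 0 = 0" and pell_1: "pell 1 = 1"
  by (simp_all add: pell_def)

lemma pell_rec: "pell k = 2 * pell (k - 1) + pell (k - 2)"
proof -
  consider n where "k = int n + 2" | "k = 1" | n where "k = - int n"
  proof (cases k rule: int_cases2)
    case (nonneg n)
    then show ?thesis
      using that(1)[of "n - 2"] that(2) that(3)[of 0] by (cases n rule: pell_nat.cases) auto
  next
    case (nonpos n)
    then show ?thesis using that(3) by blast
  qed
  then show ?thesis
  proof cases
    case 1
    then have "nat k = Suc (Suc n)" "nat (k - 1) = Suc n" "nat (k - 2) = n" by auto
    then show ?thesis using 1 by (simp add: pell_def)
  next
    case 2
    then show ?thesis by (simp add: pell_def)
  next
    case 3
    then have "nat (- k) = n" "nat (- (k - 1)) = Suc n" "nat (- (k - 2)) = Suc (Suc n)" by auto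
    then show ?thesis using 3 by (cases "n = 0") (simp_all add: pell_def numeral_2_eq_2 algebra_simps)
  qed
qed

definition dc_pell :: "int \<Rightarrow> dual_complex"
  where "dc_pell k =
    of_int (pell k) + dc_i * of_int (pell (k + 1)) + dc_eps * of_int (pell (k + 2))
      + dc_i * dc_eps * of_int (pell (k + 3))"

end

(* With a = P_(n-r), b = P_(n-r+1), p = P_r, q = P_(r-1), the addition formula
   P_(m+k) = P_k P_(m+1) + P_(k-1) P_m makes every Pell number in the identity a polynomial in
   a, b, p, q. Each of the four components of the left-hand side is then a constant multiple of
   (b^2 - 2ab - a^2) p^2, and b^2 - 2ab - a^2 = (-1)^(n-r) is Cassini's identity. *)

theory Submission
  imports Defs
begin

lemma pell_add2: "pell (k + 2) = 2 * pell (k + 1) + pell k"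
  using pell_rec[of "k + 2"] by (simp add: algebra_simps)

lemma pell_add3: "pell (k + 3) = 5 * pell (k + 1) + 2 * pell k"
  using pell_add2[of "k + 1"] pell_add2[of k] by (simp add: algebra_simps)

lemma pell_add: "pell (m + k) = pell k * pell (m + 1) + pell (k - 1) * pell m"
proof -
  \<comment> \<open>The second-order recurrence steps a pair of consecutive values up or down, so
    the claims for \<open>k\<close> and \<open>k + 1\<close> go through the two-sided induction
    together.\<close>
  have "pell (m + k) = pell k * pell (m + 1) + pell (k - 1) * pell m \<and>
      pell (m + k + 1) = pell (k + 1) * pell (m + 1) + pell k * pell m"
  proof (induction k rule: int_induct[where k = 0])
    case base
    \<comment> \<open>The recurrence at 1 gives \<open>pell (-1) = 1\<close>.\<close>
    show ?case using pell_rec[of 1] by (simp add: pell_0 pell_1)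
  next
    case (step1 i)
    then show ?case
      using pell_add2[of "m + i"] pell_add2[of i] pell_rec[of "i + 1"]
      by (simp add: algebra_simps)
  next
    case (step2 i)
    then show ?case
      using pell_rec[of "m + i + 1"] pell_rec[of "i + 1"] pell_rec[of i]
      by (simp add: algebra_simps)
  qed
  then show ?thesis ..
qed

text \<open>The shift (a, b) to (b, 2b + a) negates the form b^2 - 2ab - a^2, which is 1 at
  \<open>m = 0\<close>. The cast to reals lets \<open>powi\<close> take negative exponents.\<close>

lemma pell_cassini:
  "real_of_int ((pell (m + 1))\<^sup>2 - 2 * pell m * pell (m + 1) - (pell m)\<^sup>2) = (-1) powi m"
proof (induction m rule: int_induct[where k = 0])
  case base
  show ?case by (simp add: pell_0 pell_1)
next
  case (step1 i)
  then show ?case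
    using pell_add2[of i]
    by (simp add: power_int_add power2_eq_square algebra_simps)
next
  case (step2 i)
  then show ?case
    using pell_rec[of "i + 1"]
    by (simp add: power_int_diff power2_eq_square algebra_simps)
qed

lemma of_int_dual_complex: "of_int z = DC (of_int z) 0 0 0"
  using of_real_def[of "of_int z", where 'a = dual_complex]
  by (simp add: one_dual_complex_def scaleR_dual_complex_def)

lemma dc_pell_eq_DC: "dc_pell k = DC (pell k) (pell (k + 1)) (pell (k + 2)) (pell (k + 3))"
  by (simp add: dc_pell_def of_int_dual_complex dc_i_def dc_eps_def plus_dual_complex_def
      times_dual_complex_def)

lemma catalan_constant_eq_DC: "2 * (1 + dc_i + 6 * dc_eps + 6 * dc_i * dc_eps) = DC 2 2 12 12"
proof -
  \<comment> \<open>Numerals get their coordinates as images of integers.\<close>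
  have *: "(2 :: dual_complex) = DC 2 0 0 0" "(6 :: dual_complex) = DC 6 0 0 0"
    using of_int_dual_complex[of 2] of_int_dual_complex[of 6] by simp_all
  show ?thesis
    by (simp add: * dc_i_def dc_eps_def one_dual_complex_def plus_dual_complex_def
        times_dual_complex_def)
qed

theorem theorem3p7:
  fixes n r :: int
  assumes "n \<ge> 1" and "r \<ge> 0"
  shows "(dc_pell n)\<^sup>2 - dc_pell (n + r) * dc_pell (n - r) =
    ((-1) powi (n - r) * (real_of_int (pell r))\<^sup>2) *\<^sub>R
      (2 * (1 + dc_i + 6 * dc_eps + 6 * dc_i * dc_eps))"
proof -
  define a b p q where "a = pell (n - r)" and "b = pell (n - r + 1)"
    and "p = pell r" and "q = pell (r - 1)"
  have r1: "pell (r + 1) = 2 * p + q"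
    using pell_rec[of "r + 1"] by (simp add: p_def q_def)
  have n0: "pell n = p * b + q * a"
    using pell_add[of "n - r" r] by (simp add: a_def b_def p_def q_def)
  have n1: "pell (n + 1) = (2 * p + q) * b + p * a"
    using pell_add[of "n - r" "r + 1"] r1 by (simp add: a_def b_def p_def algebra_simps)
  \<comment> \<open>The second shift by \<open>r\<close> starts at \<open>n\<close>, so that
    \<open>n0\<close> and \<open>n1\<close> then reduce it to \<open>a\<close>, \<open>b\<close>,
    \<open>p\<close>, \<open>q\<close>.\<close>
  have nr0: "pell (n + r) = p * pell (n + 1) + q * pell n"
    using pell_add[of n r] by (simp add: p_def q_def)
  have nr1: "pell (n + r + 1) = (2 * p + q) * pell (n + 1) + p * pell n"
    using pell_add[of n "r + 1"] r1 by (simp add: p_def algebra_simps)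
  have cassini: "(-1) powi (n - r) = real_of_int (b\<^sup>2 - 2 * a * b - a\<^sup>2)"
    using pell_cassini[of "n - r"] by (simp add: a_def b_def)
  \<comment> \<open>Offsets 2 and 3 reduce to 0 and 1, and \<open>cassini\<close> turns the sign
    into a polynomial; what remains is a polynomial identity in each component, where
    \<open>q\<close> cancels.\<close>
  show ?thesis
    unfolding cassini catalan_constant_eq_DC dc_pell_eq_DC pell_add2 pell_add3 nr0 nr1 n0 n1
      p_def[symmetric] a_def[symmetric] b_def[symmetric]
    by (simp add: power2_eq_square times_dual_complex_def minus_dual_complex_def
        scaleR_dual_complex_def algebra_simps)
qed

end
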